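(* Let $\mathcal{H}$ be a complex Hilbert space, let $N\geqslant 2$, and let $A_1,\ldots,A_N$ be bounded self-adjoint operators in $\mathcal{H}$ such that $A_iA_j$ is compact for all $i\neq j$. For $\varepsilon\geqslant 0$ let $$\mathcal{H}_\varepsilon=\bigcap_{i=1}^N E_{A_i}([-\varepsilon,\varepsilon])\mathcal{H}$$ (so that $\mathcal{H}_0=\bigcap_{i=1}^N \mathrm{Ker}(A_i)\subset\mathcal{H}_\varepsilon$). If $\mathcal{H}_\varepsilon\ominus\mathcal{H}_0$ is finite dimensional for some $\varepsilon>0$, then $\sum_{i=1}^N \mathrm{Ran}(A_i)$ is closed in $\mathcal{H}$.
   Context: For a bounded self-adjoint operator $B$ in $\mathcal{H}$, $E_B(\cdot)$ denotes its projection-valued spectral measure (on Borel subsets of $\mathbb{R}$). $\mathrm{Ran}$ and $\mathrm{Ker}$ denote range and kernel, and $\sum_{i=1}^N \mathrm{Ran}(A_i)=\{\sum_{i=1}^N A_ix_i \mid x_i\in\mathcal{H}\}$ is the algebraic sum of the ranges. For closed subspaces $\mathcal{M}\subset\mathcal{L}$ of $\mathcal{H}$, $\mathcal{L}\ominus\mathcal{M}$ is the orthogonal complement of $\mathcal{M}$ in $\mathcal{L}$. *)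

theory Defs
  imports "HOL-Analysis.Analysis"
begin

(* The real inner product of real_inner (hence the norm and the topology) is the real part of
   the complex one, which is linear in its first argument. *)
class chilbert_space = real_inner + complete_space +
  fixes scaleC :: "complex \<Rightarrow> 'a \<Rightarrow> 'a" (infixr "*\<^sub>C" 75)
    and cinner :: "'a \<Rightarrow> 'a \<Rightarrow> complex"
  assumes scaleC_add_right: "c *\<^sub>C (x + y) = c *\<^sub>C x + c *\<^sub>C y"
    and scaleC_add_left: "(c + d) *\<^sub>C x = c *\<^sub>C x + d *\<^sub>C x"
    and scaleC_scaleC: "c *\<^sub>C (d *\<^sub>C x) = (c * d) *\<^sub>C x"
    and scaleC_one: "1 *\<^sub>C x = x"
    and scaleR_scaleC: "r *\<^sub>R x = complex_of_real r *\<^sub>C x"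
    and cinner_commute: "cinner x y = cnj (cinner y x)"
    and cinner_add_left: "cinner (x + y) z = cinner x z + cinner y z"
    and cinner_scaleC_left: "cinner (c *\<^sub>C x) y = c * cinner x y"
    and inner_Re_cinner: "inner x y = Re (cinner x y)"

global_interpretation cvec: vector_space "scaleC :: complex \<Rightarrow> 'a::chilbert_space \<Rightarrow> 'a"
  by unfold_locales (simp_all add: scaleC_add_right scaleC_add_left scaleC_scaleC scaleC_one)

definition finite_cdim :: "'a::chilbert_space set \<Rightarrow> bool" where
  "finite_cdim S \<longleftrightarrow> (\<exists>B. finite B \<and> S = cvec.span B)"

definition ominus :: "'a::chilbert_space set \<Rightarrow> 'a set \<Rightarrow> 'a set" (infixl "\<ominus>\<^sub>H" 65) where
  "L \<ominus>\<^sub>H M = {x \<in> L. \<forall>y\<in>M. cinner x y = 0}"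

definition bounded_clinear :: "('a::chilbert_space \<Rightarrow> 'a) \<Rightarrow> bool" where
  "bounded_clinear T \<longleftrightarrow> bounded_linear T \<and> (\<forall>c x. T (c *\<^sub>C x) = c *\<^sub>C T x)"

definition self_adjoint :: "('a::chilbert_space \<Rightarrow> 'a) \<Rightarrow> bool" where
  "self_adjoint T \<longleftrightarrow> bounded_clinear T \<and> (\<forall>x y. cinner (T x) y = cinner x (T y))"

definition compact_operator :: "('a::chilbert_space \<Rightarrow> 'a) \<Rightarrow> bool" where
  "compact_operator T \<longleftrightarrow> bounded_clinear T \<and> (\<forall>S. bounded S \<longrightarrow> compact (closure (T ` S)))"

definition orthogonal_projection :: "('a::chilbert_space \<Rightarrow> 'a) \<Rightarrow> bool" where
  "orthogonal_projection P \<longleftrightarrow> self_adjoint P \<and> P \<circ> P = P"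

(* Values of E outside the Borel sets are irrelevant; countable additivity is in the strong
   operator topology. *)
definition projection_valued_measure :: "(real set \<Rightarrow> 'a::chilbert_space \<Rightarrow> 'a) \<Rightarrow> bool" where
  "projection_valued_measure E \<longleftrightarrow>
     (\<forall>S\<in>sets borel. orthogonal_projection (E S)) \<and>
     E {} = (\<lambda>x. 0) \<and> E UNIV = id \<and>
     (\<forall>S\<in>sets borel. \<forall>T\<in>sets borel. E (S \<inter> T) = E S \<circ> E T) \<and>
     (\<forall>F::nat \<Rightarrow> real set. range F \<subseteq> sets borel \<longrightarrow> disjoint_family F \<longrightarrow>
        (\<forall>x. (\<lambda>n. E (F n) x) sums E (\<Union>n. F n) x))"

definition scalar_spectral_measure ::
    "(real set \<Rightarrow> 'a::chilbert_space \<Rightarrow> 'a) \<Rightarrow> 'a \<Rightarrow> real measure" where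
  "scalar_spectral_measure E x =
     measure_of UNIV (sets borel) (\<lambda>S. ennreal (Re (cinner (E S x) x)))"

(* A is the integral of t dE(t), in the weak sense on the diagonal (which determines the
   operator by polarization).  By the spectral theorem each bounded self-adjoint A has such an
   E, unique on the Borel sets.  The support of E is compact as A is bounded, so the
   integrand is integrable for every scalar measure. *)
definition spectral_measure_of ::
    "('a::chilbert_space \<Rightarrow> 'a) \<Rightarrow> (real set \<Rightarrow> 'a \<Rightarrow> 'a) \<Rightarrow> bool" where
  "spectral_measure_of A E \<longleftrightarrow>
     projection_valued_measure E \<and> (\<exists>a. E {-a..a} = id) \<and>
     (\<forall>x. cinner (A x) x = complex_of_real (\<integral>t. t \<partial>scalar_spectral_measure E x))"

definition spectral_intersection ::
    "nat \<Rightarrow> (nat \<Rightarrow> real set \<Rightarrow> 'a::chilbert_space \<Rightarrow> 'a) \<Rightarrow> real \<Rightarrow> 'a set" where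
  "spectral_intersection N E \<epsilon> = (\<Inter>i\<in>{1..N}. range (E i {-\<epsilon>..\<epsilon>}))"

end

theory Submission
  imports Defs
begin

text \<open>
  Everything is done in the real inner product \<open>Re \<langle>x, y\<rangle>\<close>.  Let \<open>P\<^sub>i\<close> be the spectral projection
  of \<open>A\<^sub>i\<close> onto \<open>|t| > \<epsilon>\<close>, so that \<open>\<epsilon> \<parallel>P\<^sub>i x\<parallel> \<le> \<parallel>A\<^sub>i x\<parallel>\<close>; this estimate makes \<open>P\<^sub>i P\<^sub>j\<close> compact for
  \<open>i \<noteq> j\<close>.  Pairwise compactness gives \<open>c \<parallel>v\<parallel>\<^sup>2 \<le> \<Sum> \<parallel>P\<^sub>i v\<parallel>\<^sup>2\<close> on the orthogonal complement of
  \<open>H\<^sub>\<epsilon> = \<Inter> Ker P\<^sub>i\<close>.  Hence a sequence of unit vectors orthogonal to \<open>H\<^sub>0\<close> along which all \<open>A\<^sub>i\<close> tend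
  to \<open>0\<close> approaches \<open>H\<^sub>\<epsilon> \<ominus> H\<^sub>0\<close>, and as this is finite dimensional it would accumulate at a unit
  vector in \<open>H\<^sub>0\<close>, which is absurd.  So \<open>\<Sum> A\<^sub>i\<^sup>2\<close> is bounded below on the orthogonal complement of
  \<open>H\<^sub>0\<close>, therefore maps it onto itself, and the sum of the ranges is that complement.
\<close>

section \<open>Orthogonal decomposition and finite-dimensional subspaces\<close>

text \<open>Projection theorem. By the parallelogram law a minimizing sequence for the distance from
  \<open>x\<close> to \<open>M\<close> is Cauchy; its limit is a nearest point, and moving it along
  \<open>y\<close> cannot shorten the distance.\<close>

lemma orthogonal_decomposition_complete_subspace:
  fixes M :: "'a::real_inner set"
  assumes sub: "subspace M" and comp: "complete M"
  obtains m where "m \<in> M" "\<And>y. y \<in> M \<Longrightarrow> inner (x - m) y = 0"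
proof -
  define d where "d = infdist x M"
  have ne: "M \<noteq> {}" using sub subspace_0 by blast
  have d_le: "d \<le> norm (x - y)" if "y \<in> M" for y
    using infdist_le[OF that, of x] by (simp add: d_def dist_norm)
  have d0: "d \<ge> 0" by (simp add: d_def infdist_nonneg)
  have "\<exists>y\<in>M. norm (x - y) < d + 1 / Suc n" for n
  proof -
    have "infdist x M < d + 1 / Suc n" by (simp add: d_def)
    moreover have "bdd_below ((\<lambda>y. dist x y) ` M)" by (rule bdd_belowI2[of _ 0]) simp
    ultimately show ?thesis
      using infdist_notempty[OF ne, of x] ne cINF_less_iff[of M "\<lambda>y. dist x y"] by (auto simp: dist_norm)
  qed
  then obtain f where fM: "\<And>n. f n \<in> M" and f: "\<And>n. norm (x - f n) < d + 1 / Suc n"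
    by metis
  have sq: "(norm (x - f n))\<^sup>2 \<le> d\<^sup>2 + (2 * d + 1) / Suc n" for n
  proof -
    have "(norm (x - f n))\<^sup>2 \<le> (d + 1 / Suc n)\<^sup>2"
      using f[of n] by (intro power_mono) auto
    also have "\<dots> = d\<^sup>2 + 2 * d / Suc n + (1 / Suc n) * (1 / Suc n)"
      by (simp add: power2_eq_square algebra_simps)
    also have "(1 / Suc n) * (1 / Suc n) \<le> 1 / Suc n * 1"
      by (intro mult_left_mono) auto
    finally show ?thesis by (simp add: add_divide_distrib)
  qed
  \<comment> \<open>The midpoint of \<open>f m\<close> and \<open>f n\<close> lies in
    \<open>M\<close>, so its distance to \<open>x\<close> is at least \<open>d\<close>.\<close>
  have parallelogram: "(norm (f m - f n))\<^sup>2 \<le> 2 * ((2 * d + 1) / Suc m + (2 * d + 1) / Suc n)" for m n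
  proof -
    have "(1/2) *\<^sub>R (f m + f n) \<in> M" using sub fM by (meson subspace_add subspace_scale)
    then have "d\<^sup>2 \<le> (norm (x - (1/2) *\<^sub>R (f m + f n)))\<^sup>2"
      using d_le d0 by (intro power_mono)
    moreover have "(norm (f m - f n))\<^sup>2 = 2 * (norm (x - f m))\<^sup>2 + 2 * (norm (x - f n))\<^sup>2
        - 4 * (norm (x - (1/2) *\<^sub>R (f m + f n)))\<^sup>2"
      by (simp add: power2_norm_eq_inner inner_simps inner_commute algebra_simps)
    ultimately show ?thesis
      using sq[of m] sq[of n] by (smt (verit))
  qed
  have quarter: "z < c" if "a < c / 4" "b < c / 4" "z \<le> 2 * (a + b)" for a b c z :: real
    using that by simp
  have "Cauchy f"
  proof (rule metric_CauchyI)
    fix e :: real assume e: "e > 0"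
    obtain K where K: "4 * (2 * d + 1) / e\<^sup>2 < real K" using reals_Archimedean2 by blast
    have "dist (f m) (f n) < e" if "m \<ge> K" "n \<ge> K" for m n
    proof -
      have le: "(2 * d + 1) / Suc k < e\<^sup>2 / 4" if "k \<ge> K" for k
      proof -
        have "4 * (2 * d + 1) / e\<^sup>2 < real (Suc k)" using K that by linarith
        then show ?thesis using e by (simp add: field_simps)
      qed
      have "(norm (f m - f n))\<^sup>2 < e\<^sup>2"
        using quarter[OF le[OF that(1)] le[OF that(2)] parallelogram] .
      then show ?thesis using e by (metis dist_norm less_imp_le power_less_imp_less_base)
    qed
    then show "\<exists>K. \<forall>m\<ge>K. \<forall>n\<ge>K. dist (f m) (f n) < e" by blast
  qed
  then obtain m where m: "m \<in> M" "f \<longlonglongrightarrow> m"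
    using comp fM unfolding complete_def by blast
  have "(\<lambda>n. norm (x - f n)) \<longlonglongrightarrow> norm (x - m)" by (intro tendsto_intros m)
  moreover have "(\<lambda>n. d + 1 / Suc n) \<longlonglongrightarrow> d + 0"
    by (intro tendsto_add tendsto_const LIMSEQ_Suc lim_1_over_n)
  ultimately have xm: "norm (x - m) \<le> d"
    using f by (intro LIMSEQ_le[of _ "norm (x - m)" _ d]) (auto intro: less_imp_le)
  have "inner (x - m) y = 0" if y: "y \<in> M" for y
  proof (cases "y = 0")
    case False
    \<comment> \<open>This \<open>t\<close> minimizes the distance from \<open>x\<close> to the line
      \<open>m + t *\<^sub>R y\<close>.\<close>
    define t where "t = inner (x - m) y / (norm y)\<^sup>2"
    have "m + t *\<^sub>R y \<in> M" using sub m y by (simp add: subspace_add subspace_scale)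
    then have "(norm (x - m))\<^sup>2 \<le> (norm (x - (m + t *\<^sub>R y)))\<^sup>2"
      using d_le xm by (intro power_mono) (auto intro: order_trans)
    also have "\<dots> = (norm (x - m))\<^sup>2 - 2 * t * inner (x - m) y + t\<^sup>2 * (norm y)\<^sup>2"
      using dot_norm_neg[of "x - m" "t *\<^sub>R y"] by (simp add: power_mult_distrib diff_diff_eq)
    also have "\<dots> = (norm (x - m))\<^sup>2 - (inner (x - m) y)\<^sup>2 / (norm y)\<^sup>2"
      using False by (simp add: t_def power2_eq_square field_simps)
    finally have "(inner (x - m) y)\<^sup>2 / (norm y)\<^sup>2 \<le> 0" by simp
    then show ?thesis using False by (simp add: divide_le_0_iff)
  qed simp
  with m show ?thesis using that by blast
qed

text \<open>Induction on the generators: the new one is replaced by its component \<open>q\<close>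
  orthogonal to the old span. By Pythagoras both components of a vector in the ball are then
  bounded, so the ball is cut out of a continuous image of a compact product.\<close>

lemma compact_span_Int_cball:
  fixes B :: "'a::{real_inner,complete_space} set"
  assumes "finite B"
  shows "compact (span B \<inter> cball 0 r)"
  using assms
proof (induction B arbitrary: r rule: finite_induct)
  case empty
  then show ?case by (simp add: compact_Int_closed)
next
  case (insert b B)
  \<comment> \<open>A convergent sequence stays in some ball, and the induction hypothesis covers
    every radius.\<close>
  have "closed (span B)"
    unfolding closed_sequential_limits
  proof (intro allI impI, elim conjE)
    fix f l assume f: "\<forall>n. f n \<in> span B" "f \<longlonglongrightarrow> l"
    then obtain R where "\<And>n. norm (f n) \<le> R"
      using convergent_imp_bounded[OF f(2)] by (auto simp: bounded_iff)
    then have "\<forall>n. f n \<in> span B \<inter> cball 0 R" using f by simp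
    moreover have "closed (span B \<inter> cball 0 R)" using insert.IH compact_imp_closed by blast
    ultimately show "l \<in> span B" using f(2) unfolding closed_sequential_limits by blast
  qed
  then have "complete (span B)" by (simp add: complete_eq_closed)
  then obtain p where p: "p \<in> span B" and orth: "\<And>y. y \<in> span B \<Longrightarrow> inner (b - p) y = 0"
    using orthogonal_decomposition_complete_subspace[OF subspace_span] by blast
  define q where "q = b - p"
  \<comment> \<open>Bound for the coefficient of \<open>q\<close>. If \<open>q = 0\<close>, division
    by zero gives \<open>K = 0\<close>, and the coefficient 0 then suffices.\<close>
  define K where "K = r / norm q"
  let ?C = "(\<lambda>(s, t). s + t *\<^sub>R q) ` ((span B \<inter> cball 0 r) \<times> {-K..K})"
  have span: "span (insert b B) = {s + t *\<^sub>R q | s t. s \<in> span B}" (is "_ = ?R")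
  proof
    show "span (insert b B) \<subseteq> ?R"
    proof
      fix x assume "x \<in> span (insert b B)"
      then obtain k where "x - k *\<^sub>R b \<in> span B" by (auto simp: span_insert)
      then have "x - k *\<^sub>R b + k *\<^sub>R p \<in> span B" by (intro span_add span_scale p)
      moreover have "x = (x - k *\<^sub>R b + k *\<^sub>R p) + k *\<^sub>R q" by (simp add: q_def algebra_simps)
      ultimately show "x \<in> ?R" by blast
    qed
    have "span B \<subseteq> span (insert b B)" by (intro span_mono) auto
    then show "?R \<subseteq> span (insert b B)"
      using p span_base[of b "insert b B"] by (auto simp: q_def intro!: span_add span_scale span_diff)
  qed
  have "span (insert b B) \<inter> cball 0 r = ?C \<inter> cball 0 r"
  proof
    show "?C \<inter> cball 0 r \<subseteq> span (insert b B) \<inter> cball 0 r" unfolding span by auto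
    show "span (insert b B) \<inter> cball 0 r \<subseteq> ?C \<inter> cball 0 r"
    proof
      fix x assume x: "x \<in> span (insert b B) \<inter> cball 0 r"
      then obtain s t where s: "s \<in> span B" and xst: "x = s + t *\<^sub>R q" unfolding span by auto
      have r: "norm x \<le> r" using x by simp
      have "(norm x)\<^sup>2 = (norm s)\<^sup>2 + (norm (t *\<^sub>R q))\<^sup>2"
        unfolding xst using orth[OF s]
        by (intro norm_add_Pythagorean) (simp add: orthogonal_def q_def inner_commute)
      then have "(norm s)\<^sup>2 \<le> (norm x)\<^sup>2" "(norm (t *\<^sub>R q))\<^sup>2 \<le> (norm x)\<^sup>2" by simp_all
      then have sr: "norm s \<le> r" and tr: "norm (t *\<^sub>R q) \<le> r"
        using r by (meson norm_ge_zero order_trans power2_le_imp_le)+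
      show "x \<in> ?C \<inter> cball 0 r"
      proof (cases "q = 0")
        case True
        then have "K = 0" by (simp add: K_def)
        then have "(s, 0) \<in> (span B \<inter> cball 0 r) \<times> {-K..K}" using s sr by simp
        then show ?thesis using x True by (force simp: xst)
      next
        case False
        then have "\<bar>t\<bar> \<le> K" using tr by (simp add: K_def field_simps)
        then have "(s, t) \<in> (span B \<inter> cball 0 r) \<times> {-K..K}" using s sr by auto
        then show ?thesis using x by (force simp: xst)
      qed
    qed
  qed
  moreover have "compact ?C"
    by (intro compact_continuous_image compact_Times insert.IH compact_Icc)
       (auto simp: case_prod_unfold intro!: continuous_intros)
  ultimately show ?case by (simp add: compact_Int_closed)
qed

section \<open>Relatively compact maps\<close>

text \<open>Sequential compactness asking only for Cauchy subsequences, so that for linear maps it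
  transfers along norm estimates without identifying limits.\<close>

definition relatively_compact_map :: "('a::metric_space \<Rightarrow> 'b::metric_space) \<Rightarrow> bool" where
  "relatively_compact_map T \<longleftrightarrow>
     (\<forall>x. bounded (range x) \<longrightarrow> (\<exists>r::nat \<Rightarrow> nat. strict_mono r \<and> Cauchy (\<lambda>n. T (x (r n)))))"

lemma Cauchy_subseq:
  assumes "Cauchy f" "strict_mono (r :: nat \<Rightarrow> nat)"
  shows "Cauchy (\<lambda>n. f (r n))"
  using Cauchy_subseq_Cauchy[OF assms] by (simp add: comp_def)

lemma bounded_range_subseq: "bounded (range x) \<Longrightarrow> bounded (range (\<lambda>n. x (r n)))"
  by (rule bounded_subset) auto

text \<open>The estimate, applied to differences of sequence members, carries the Cauchy property
  from \<open>T\<close> to \<open>S\<close>.\<close>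

lemma relatively_compact_map_dominated:
  fixes T :: "'a::real_normed_vector \<Rightarrow> 'b::real_normed_vector"
    and S :: "'a \<Rightarrow> 'c::real_normed_vector"
  assumes T: "relatively_compact_map T" "linear T" and S: "linear S"
    and le: "\<And>x. norm (S x) \<le> C * norm (T x)"
  shows "relatively_compact_map S"
  unfolding relatively_compact_map_def
proof (intro allI impI)
  fix x :: "nat \<Rightarrow> 'a" assume "bounded (range x)"
  then obtain r where r: "strict_mono r" "Cauchy (\<lambda>n. T (x (r n)))"
    using T(1) unfolding relatively_compact_map_def by blast
  have "Cauchy (\<lambda>n. S (x (r n)))"
  proof (rule metric_CauchyI)
    fix e :: real assume e: "e > 0"
    \<comment> \<open>The sign of \<open>C\<close> is unknown, so a positive majorant of it is
      used.\<close>
    then have "e / (\<bar>C\<bar> + 1) > 0" by simp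
    then obtain K where K: "\<And>m n. m \<ge> K \<Longrightarrow> n \<ge> K \<Longrightarrow> dist (T (x (r m))) (T (x (r n))) < e / (\<bar>C\<bar> + 1)"
      using r(2) unfolding Cauchy_def by blast
    have "dist (S (x (r m))) (S (x (r n))) < e" if "m \<ge> K" "n \<ge> K" for m n
    proof -
      let ?z = "x (r m) - x (r n)"
      have "norm (S ?z) \<le> C * norm (T ?z)" by (rule le)
      also have "\<dots> \<le> (\<bar>C\<bar> + 1) * norm (T ?z)" by (intro mult_right_mono) auto
      also have "\<dots> < e"
        using K[OF that] by (simp add: dist_norm linear_diff[OF T(2)] field_simps)
      finally show ?thesis by (simp add: dist_norm linear_diff[OF S])
    qed
    then show "\<exists>K. \<forall>m\<ge>K. \<forall>n\<ge>K. dist (S (x (r m))) (S (x (r n))) < e" by blast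
  qed
  with r(1) show "\<exists>r. strict_mono r \<and> Cauchy (\<lambda>n. S (x (r n)))" by blast
qed

text \<open>A form of Schauder's theorem: \<open>\<parallel>A P y\<parallel>\<^sup>2 = \<langle>P A (A P y), y\<rangle>\<close>.\<close>

lemma relatively_compact_map_swap:
  fixes A P :: "'a::real_inner \<Rightarrow> 'a"
  assumes A: "bounded_linear A" "\<And>x y. inner (A x) y = inner x (A y)"
    and P: "bounded_linear P" "\<And>x y. inner (P x) y = inner x (P y)"
    and PA: "relatively_compact_map (P \<circ> A)"
  shows "relatively_compact_map (A \<circ> P)"
  unfolding relatively_compact_map_def
proof (intro allI impI)
  fix x :: "nat \<Rightarrow> 'a" assume bx: "bounded (range x)"
  have "bounded_linear (\<lambda>x. A (P x))" using A(1) P(1) bounded_linear_compose by blast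
  from bounded_linear_image[OF bx this] have "bounded (range (\<lambda>n. A (P (x n))))"
    by (simp add: image_image)
  \<comment> \<open>Compactness of \<open>P \<circ> A\<close> is used along the bounded sequence
    \<open>A (P (x n))\<close>.\<close>
  then obtain r :: "nat \<Rightarrow> nat" where r: "strict_mono r" "Cauchy (\<lambda>n. P (A (A (P (x (r n))))))"
    using PA unfolding relatively_compact_map_def comp_def by blast
  obtain C where C: "C > 0" "\<And>n. norm (x n) \<le> C"
    using bx unfolding bounded_pos by auto
  have "Cauchy (\<lambda>n. A (P (x (r n))))"
  proof (rule metric_CauchyI)
    fix e :: real assume e: "e > 0"
    then have "e\<^sup>2 / (2 * C) > 0" using C by simp
    then obtain K where K: "\<And>m n. m \<ge> K \<Longrightarrow> n \<ge> K \<Longrightarrow>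
        dist (P (A (A (P (x (r m)))))) (P (A (A (P (x (r n)))))) < e\<^sup>2 / (2 * C)"
      using r(2) unfolding Cauchy_def by blast
    have "dist (A (P (x (r m)))) (A (P (x (r n)))) < e" if "m \<ge> K" "n \<ge> K" for m n
    proof -
      let ?z = "x (r m) - x (r n)"
      have lin: "A (u - v) = A u - A v" "P (u - v) = P u - P v" for u v
        using A(1) P(1) by (simp_all add: linear_diff bounded_linear.linear)
      have "(norm (A (P ?z)))\<^sup>2 = inner (P (A (A (P ?z)))) ?z"
        by (simp add: power2_norm_eq_inner A P)
      also have "\<dots> \<le> norm (P (A (A (P ?z)))) * norm ?z" by (rule norm_cauchy_schwarz)
      also have "\<dots> \<le> norm (P (A (A (P ?z)))) * (2 * C)"
        using norm_triangle_ineq4[of "x (r m)" "x (r n)"] C(2)[of "r m"] C(2)[of "r n"]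
        by (intro mult_left_mono) auto
      also have "\<dots> < e\<^sup>2"
        using K[OF that] C(1) by (simp add: dist_norm lin field_simps)
      finally have "norm (A (P ?z)) < e" using e by (meson less_imp_le power_less_imp_less_base)
      then show ?thesis by (simp add: dist_norm lin)
    qed
    then show "\<exists>K. \<forall>m\<ge>K. \<forall>n\<ge>K. dist (A (P (x (r m)))) (A (P (x (r n)))) < e" by blast
  qed
  with r(1) show "\<exists>r. strict_mono r \<and> Cauchy (\<lambda>n. (A \<circ> P) (x (r n)))" by auto
qed

text \<open>Successive extraction: passing to a further subsequence preserves the Cauchy properties
  already secured. Each index carries its own sequence because a product
  \<open>P i \<circ> P j\<close> will be tested along \<open>P j (y n)\<close>.\<close>

lemma relatively_compact_map_common_subseq:
  assumes "finite K" "\<And>k. k \<in> K \<Longrightarrow> relatively_compact_map (T k)"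
    "\<And>k. k \<in> K \<Longrightarrow> bounded (range (x k))"
  obtains r :: "nat \<Rightarrow> nat" where "strict_mono r" "\<And>k. k \<in> K \<Longrightarrow> Cauchy (\<lambda>n. T k (x k (r n)))"
proof -
  have "\<exists>r::nat \<Rightarrow> nat. strict_mono r \<and> (\<forall>k\<in>K. Cauchy (\<lambda>n. T k (x k (r n))))"
    using assms
  proof (induction K rule: finite_induct)
    case empty
    show ?case using strict_mono_id by auto
  next
    case (insert k K)
    then obtain r :: "nat \<Rightarrow> nat" where r: "strict_mono r" "\<forall>k\<in>K. Cauchy (\<lambda>n. T k (x k (r n)))"
      by auto
    have "bounded (range (\<lambda>n. x k (r n)))" using insert.prems bounded_range_subseq[of "x k"] by simp
    moreover have "relatively_compact_map (T k)" using insert.prems by simp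
    ultimately obtain s :: "nat \<Rightarrow> nat" where s: "strict_mono s" "Cauchy (\<lambda>n. T k (x k (r (s n))))"
      unfolding relatively_compact_map_def by meson
    have "strict_mono (\<lambda>n. r (s n))" using r(1) s(1) by (simp add: strict_mono_def)
    moreover have "\<forall>j\<in>insert k K. Cauchy (\<lambda>n. T j (x j (r (s n))))"
    proof
      fix j assume j: "j \<in> insert k K"
      show "Cauchy (\<lambda>n. T j (x j (r (s n))))"
      proof (cases "j = k")
        case False
        then have "Cauchy (\<lambda>n. T j (x j (r n)))" using j r(2) by simp
        then show ?thesis using s(1) by (rule Cauchy_subseq)
      qed (simp add: s(2))
    qed
    ultimately show ?case by blast
  qed
  then show ?thesis using that by meson
qed

section \<open>Families of projections with compact products\<close>

text \<open>If the bound fails along \<open>y\<^sub>n\<close>, then \<open>P\<^sub>i y\<^sub>n = P\<^sub>i (\<Sum>\<^sub>j P\<^sub>j y\<^sub>n) - \<Sum>\<^bsub>j\<noteq>i\<^esub> P\<^sub>i P\<^sub>j (P\<^sub>j y\<^sub>n)\<close> converges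
  along a subsequence to some \<open>w\<^sub>i\<close> with \<open>\<Sum> w\<^sub>i = 0\<close>, and \<open>\<Sum> \<langle>P\<^sub>i y\<^sub>n, w\<^sub>i\<rangle> = \<langle>y\<^sub>n, \<Sum> w\<^sub>i\<rangle> = 0\<close>
  forces all \<open>w\<^sub>i\<close> to vanish, although no bound on \<open>y\<^sub>n\<close> is available.\<close>

lemma projection_family_sum_lower_bound:
  fixes P :: "'i \<Rightarrow> 'a::{real_inner,complete_space} \<Rightarrow> 'a"
  assumes fin: "finite I" and bl: "\<And>i. i \<in> I \<Longrightarrow> bounded_linear (P i)"
    and sym: "\<And>i x y. i \<in> I \<Longrightarrow> inner (P i x) y = inner x (P i y)"
    and idem: "\<And>i x. i \<in> I \<Longrightarrow> P i (P i x) = P i x"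
    and comp: "\<And>i j. i \<in> I \<Longrightarrow> j \<in> I \<Longrightarrow> i \<noteq> j \<Longrightarrow> relatively_compact_map (P i \<circ> P j)"
  shows "\<exists>c>0. \<forall>y. c * (\<Sum>i\<in>I. (norm (P i y))\<^sup>2) \<le> (norm (\<Sum>i\<in>I. P i y))\<^sup>2"
proof (rule ccontr)
  define Q where "Q y = (\<Sum>i\<in>I. (norm (P i y))\<^sup>2)" for y
  define R where "R y = (\<Sum>i\<in>I. P i y)" for y
  have scale: "P i (t *\<^sub>R y) = t *\<^sub>R P i y" if "i \<in> I" for i t y
    using bl[OF that] by (simp add: linear_scale bounded_linear.linear)
  have Q0: "Q y \<ge> 0" for y by (simp add: Q_def sum_nonneg)
  assume "\<not> ?thesis"
  then have neg: "\<And>c. c > 0 \<Longrightarrow> \<exists>y. (norm (R y))\<^sup>2 < c * Q y"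
    by (force simp: Q_def R_def not_le)
  have "\<exists>y. Q y = 1 \<and> (norm (R y))\<^sup>2 < 1 / Suc n" for n
  proof -
    obtain y where y: "(norm (R y))\<^sup>2 < 1 / Suc n * Q y" using neg[of "1 / Suc n"] by auto
    then have Qp: "Q y > 0" using Q0[of y] by (cases "Q y = 0") auto
    \<comment> \<open>Both sides are quadratic in \<open>y\<close>, so a counterexample can be
      rescaled to \<open>Q y = 1\<close>.\<close>
    define t where "t = 1 / sqrt (Q y)"
    have t2: "t\<^sup>2 = 1 / Q y" using Qp by (simp add: t_def power_divide)
    have "Q (t *\<^sub>R y) = t\<^sup>2 * Q y"
      by (simp add: Q_def scale power_mult_distrib sum_distrib_left)
    moreover have "R (t *\<^sub>R y) = t *\<^sub>R R y"
      by (simp add: R_def scale scaleR_sum_right)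
    ultimately have "Q (t *\<^sub>R y) = 1 \<and> (norm (R (t *\<^sub>R y)))\<^sup>2 < 1 / Suc n"
      using y Qp by (simp add: t2 power_mult_distrib field_simps)
    then show ?thesis by blast
  qed
  then obtain y where y1: "\<And>n. Q (y n) = 1" and yR: "\<And>n. (norm (R (y n)))\<^sup>2 < 1 / Suc n" by metis
  have "(\<lambda>n. (norm (R (y n)))\<^sup>2) \<longlonglongrightarrow> 0"
  proof (rule tendsto_sandwich)
    show "(\<lambda>_. 0::real) \<longlonglongrightarrow> 0" by (rule tendsto_const)
    show "(\<lambda>n. 1 / real (Suc n)) \<longlonglongrightarrow> 0" using LIMSEQ_Suc[OF lim_1_over_n] .
    show "\<forall>\<^sub>F n in sequentially. (norm (R (y n)))\<^sup>2 \<le> 1 / real (Suc n)"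
      using yR less_imp_le by (intro always_eventually allI) blast
  qed simp
  then have "(\<lambda>n. sqrt ((norm (R (y n)))\<^sup>2)) \<longlonglongrightarrow> sqrt 0" by (rule tendsto_real_sqrt)
  then have R0: "(\<lambda>n. R (y n)) \<longlonglongrightarrow> 0" by (simp add: tendsto_norm_zero_iff)
  \<comment> \<open>Only the components \<open>P i (y n)\<close> are known to be bounded;
    compactness is applied to them instead of \<open>y n\<close>.\<close>
  have "norm (P i (y n)) \<le> 1" if "i \<in> I" for i n
  proof -
    have "(norm (P i (y n)))\<^sup>2 \<le> Q (y n)" unfolding Q_def using fin that by (intro member_le_sum) auto
    then show ?thesis using y1 by (simp add: power_le_one_iff abs_square_le_1)
  qed
  then have bdd: "bounded (range (\<lambda>n. P i (y n)))" if "i \<in> I" for i using that by (auto simp: bounded_iff)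
  define K where "K = {(i, j). i \<in> I \<and> j \<in> I \<and> i \<noteq> j}"
  have "finite K" using fin by (intro finite_subset[of K "I \<times> I"]) (auto simp: K_def)
  then obtain r :: "nat \<Rightarrow> nat" where r: "strict_mono r"
    and rK: "\<And>k. k \<in> K \<Longrightarrow> Cauchy (\<lambda>n. (P (fst k) \<circ> P (snd k)) (P (snd k) (y (r n))))"
    by (rule relatively_compact_map_common_subseq[where K = K and T = "\<lambda>k. P (fst k) \<circ> P (snd k)"
          and x = "\<lambda>k n. P (snd k) (y n)"]) (auto simp: K_def comp bdd)
  have R0r: "(\<lambda>n. R (y (r n))) \<longlonglongrightarrow> 0"
    using LIMSEQ_subseq_LIMSEQ[OF R0 r] by (simp add: comp_def)
  have "convergent (\<lambda>n. P i (y (r n)))" if i: "i \<in> I" for i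
  proof -
    have eq: "P i (y n) = P i (R (y n)) - (\<Sum>j\<in>I - {i}. P i (P j (P j (y n))))" for n
    proof -
      have "P i (R (y n)) = (\<Sum>j\<in>I. P i (P j (y n)))"
        unfolding R_def using bl[OF i] by (simp add: linear_sum bounded_linear.linear)
      also have "\<dots> = P i (P i (y n)) + (\<Sum>j\<in>I - {i}. P i (P j (y n)))"
        by (rule sum.remove[OF fin i])
      finally show ?thesis using i by (simp add: idem)
    qed
    have "convergent (\<lambda>n. P i (R (y (r n))))"
      using bounded_linear.tendsto[OF bl[OF i] R0r] by (auto simp: convergent_def)
    moreover have "convergent (\<lambda>n. P i (P j (P j (y (r n)))))" if "j \<in> I - {i}" for j
      using rK[of "(i, j)"] that i by (auto simp add: K_def Cauchy_convergent_iff)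
    ultimately have "convergent (\<lambda>n. P i (R (y (r n))) - (\<Sum>j\<in>I - {i}. P i (P j (P j (y (r n))))))"
      by (rule convergent_diff[OF _ convergent_sum])
    moreover have "(\<lambda>n. P i (y (r n))) = (\<lambda>n. P i (R (y (r n))) - (\<Sum>j\<in>I - {i}. P i (P j (P j (y (r n))))))"
      by (rule ext) (rule eq)
    ultimately show ?thesis by (rule ssubst[rotated, where P = convergent])
  qed
  then obtain w where w: "\<And>i. i \<in> I \<Longrightarrow> (\<lambda>n. P i (y (r n))) \<longlonglongrightarrow> w i"
    unfolding convergent_def by metis
  have "(\<lambda>n. R (y (r n))) \<longlonglongrightarrow> (\<Sum>i\<in>I. w i)" unfolding R_def by (intro tendsto_sum w)
  then have w0: "(\<Sum>i\<in>I. w i) = 0" using R0r LIMSEQ_unique by blast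
  \<comment> \<open>The limit stays in the range of the projection, which lets \<open>P i\<close> be
    moved across the inner product and absorbed by \<open>w i\<close> below.\<close>
  have Pw: "P i (w i) = w i" if i: "i \<in> I" for i
    using bounded_linear.tendsto[OF bl[OF i] w[OF i]] w[OF i] LIMSEQ_unique by (auto simp: idem i)
  have "(\<lambda>n. \<Sum>i\<in>I. inner (P i (y (r n))) (w i)) \<longlonglongrightarrow> (\<Sum>i\<in>I. inner (w i) (w i))"
    by (intro tendsto_sum tendsto_inner w tendsto_const)
  moreover have "(\<Sum>i\<in>I. inner (P i (y (r n))) (w i)) = 0" for n
  proof -
    have "(\<Sum>i\<in>I. inner (P i (y (r n))) (w i)) = inner (y (r n)) (\<Sum>i\<in>I. w i)"
      by (simp add: sym Pw inner_sum_right)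
    then show ?thesis by (simp add: w0)
  qed
  ultimately have "(\<Sum>i\<in>I. inner (w i) (w i)) = 0" using LIMSEQ_unique[OF _ tendsto_const] by auto
  moreover have "(\<lambda>n. Q (y (r n))) \<longlonglongrightarrow> (\<Sum>i\<in>I. (norm (w i))\<^sup>2)"
    unfolding Q_def by (intro tendsto_intros w)
  then have "(\<Sum>i\<in>I. (norm (w i))\<^sup>2) = 1" using LIMSEQ_unique[OF _ tendsto_const] y1 by auto
  ultimately show False by (simp add: power2_norm_eq_inner)
qed

lemma subspace_closure:
  fixes S :: "'a::real_normed_vector set"
  assumes "subspace S"
  shows "subspace (closure S)"
proof (rule subspaceI)
  show "0 \<in> closure S" using subspace_0[OF assms] closure_subset by blast
  fix x y assume "x \<in> closure S" "y \<in> closure S"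
  then obtain f g where "\<forall>n. f n \<in> S" "f \<longlonglongrightarrow> x" "\<forall>n. g n \<in> S" "g \<longlonglongrightarrow> y"
    unfolding closure_sequential by blast
  then have "\<forall>n. f n + g n \<in> S" "(\<lambda>n. f n + g n) \<longlonglongrightarrow> x + y"
    using assms by (auto intro: subspace_add tendsto_add)
  then show "x + y \<in> closure S"
    unfolding closure_sequential by (intro exI[of _ "\<lambda>n. f n + g n"] conjI)
next
  fix c x assume "x \<in> closure S"
  then obtain f where "\<forall>n. f n \<in> S" "f \<longlonglongrightarrow> x"
    unfolding closure_sequential by blast
  then have "\<forall>n. c *\<^sub>R f n \<in> S" "(\<lambda>n. c *\<^sub>R f n) \<longlonglongrightarrow> c *\<^sub>R x"
    using assms by (auto intro: subspace_scale tendsto_intros)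
  then show "c *\<^sub>R x \<in> closure S"
    unfolding closure_sequential by (intro exI[of _ "\<lambda>n. c *\<^sub>R f n"] conjI)
qed

text \<open>The preceding estimate is dualized. For \<open>v = R y\<close> the square of the norm is
  paired with the components \<open>P i y\<close>, whose size the preceding estimate controls. The
  bound extends by continuity to the closure of the range of \<open>R\<close>, which contains every
  vector orthogonal to the common kernel.\<close>

lemma projection_family_lower_bound:
  fixes P :: "'i \<Rightarrow> 'a::{real_inner,complete_space} \<Rightarrow> 'a"
  assumes fin: "finite I" and bl: "\<And>i. i \<in> I \<Longrightarrow> bounded_linear (P i)"
    and sym: "\<And>i x y. i \<in> I \<Longrightarrow> inner (P i x) y = inner x (P i y)"
    and idem: "\<And>i x. i \<in> I \<Longrightarrow> P i (P i x) = P i x"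
    and comp: "\<And>i j. i \<in> I \<Longrightarrow> j \<in> I \<Longrightarrow> i \<noteq> j \<Longrightarrow> relatively_compact_map (P i \<circ> P j)"
  shows "\<exists>c>0. \<forall>v. (\<forall>d. (\<forall>i\<in>I. P i d = 0) \<longrightarrow> inner v d = 0) \<longrightarrow>
           c * (norm v)\<^sup>2 \<le> (\<Sum>i\<in>I. (norm (P i v))\<^sup>2)"
proof -
  obtain c where c: "c > 0"
    and lower: "\<And>y. c * (\<Sum>i\<in>I. (norm (P i y))\<^sup>2) \<le> (norm (\<Sum>i\<in>I. P i y))\<^sup>2"
    using projection_family_sum_lower_bound[of I P, OF fin bl sym idem comp] by blast
  define R where "R y = (\<Sum>i\<in>I. P i y)" for y
  have R: "bounded_linear R" unfolding R_def by (intro bounded_linear_sum bl)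
  define C where "C = {v. c * (norm v)\<^sup>2 \<le> (\<Sum>i\<in>I. (norm (P i v))\<^sup>2)}"
  have "closed C"
    unfolding C_def
    by (intro closed_Collect_le continuous_intros linear_continuous_on bl)
  moreover have "range R \<subseteq> C"
  proof
    fix v assume "v \<in> range R"
    then obtain y where v: "v = R y" by blast
    have "(norm v)\<^sup>2 = (\<Sum>i\<in>I. inner (P i v) (P i y))"
    proof -
      have "inner v (P i y) = inner (P i v) (P i y)" if "i \<in> I" for i
        using sym[OF that, of v "P i y"] idem[OF that] by simp
      moreover have "(norm v)\<^sup>2 = (\<Sum>i\<in>I. inner v (P i y))"
        by (subst power2_norm_eq_inner, subst (2) v) (simp add: R_def inner_sum_right)
      ultimately show ?thesis by simp
    qed
    \<comment> \<open>Young's inequality with weight \<open>c\<close>: by \<open>lower\<close> the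
      second sum costs at most half of the squared norm of \<open>v\<close>, which the left side
      absorbs. The constant \<open>c\<close> is thereby unchanged.\<close>
    also have "\<dots> \<le> (\<Sum>i\<in>I. (norm (P i v))\<^sup>2 / (2 * c) + c * (norm (P i y))\<^sup>2 / 2)"
    proof (rule sum_mono)
      fix i
      have "inner (P i v) (P i y) \<le> norm (P i v) * norm (P i y)" by (rule norm_cauchy_schwarz)
      moreover have "0 \<le> (norm (P i v) - c * norm (P i y))\<^sup>2" by simp
      then have "2 * c * (norm (P i v) * norm (P i y)) \<le> (norm (P i v))\<^sup>2 + c\<^sup>2 * (norm (P i y))\<^sup>2"
        by (simp add: power2_eq_square algebra_simps)
      then have "norm (P i v) * norm (P i y) \<le> (norm (P i v))\<^sup>2 / (2 * c) + c * (norm (P i y))\<^sup>2 / 2"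
        using c by (simp add: field_simps power2_eq_square)
      ultimately show "inner (P i v) (P i y) \<le> (norm (P i v))\<^sup>2 / (2 * c) + c * (norm (P i y))\<^sup>2 / 2"
        by linarith
    qed
    also have "\<dots> = (\<Sum>i\<in>I. (norm (P i v))\<^sup>2) / (2 * c) + c * (\<Sum>i\<in>I. (norm (P i y))\<^sup>2) / 2"
      by (simp add: sum.distrib sum_divide_distrib sum_distrib_left)
    also have "\<dots> \<le> (\<Sum>i\<in>I. (norm (P i v))\<^sup>2) / (2 * c) + (norm v)\<^sup>2 / 2"
      using lower[of y] by (simp add: v R_def)
    finally show "v \<in> C" using c by (simp add: C_def field_simps)
  qed
  ultimately have clC: "closure (range R) \<subseteq> C" by (rule closure_minimal[rotated])
  have sub: "subspace (closure (range R))"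
    by (rule subspace_closure) (rule linear_subspace_image[OF bounded_linear.linear[OF R] subspace_UNIV])
  have "c * (norm v)\<^sup>2 \<le> (\<Sum>i\<in>I. (norm (P i v))\<^sup>2)"
    if v: "\<forall>d. (\<forall>i\<in>I. P i d = 0) \<longrightarrow> inner v d = 0" for v
  proof -
    obtain m where m: "m \<in> closure (range R)"
      and orth: "\<And>y. y \<in> closure (range R) \<Longrightarrow> inner (v - m) y = 0"
      using orthogonal_decomposition_complete_subspace[OF sub, of v] by (auto simp: complete_eq_closed)
    \<comment> \<open>This \<open>d\<close> is orthogonal to \<open>R d\<close>, which forces it
      into the common kernel. It is then orthogonal to both \<open>v\<close> and \<open>m\<close>,
      hence zero.\<close>
    define d where "d = v - m"
    have "inner d (R d) = 0"
      using orth[of "R d"] closure_subset[of "range R"] by (auto simp: d_def)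
    moreover have "inner d (R d) = (\<Sum>i\<in>I. (norm (P i d))\<^sup>2)"
      unfolding R_def inner_sum_right
    proof (rule sum.cong)
      fix i assume "i \<in> I"
      then show "inner d (P i d) = (norm (P i d))\<^sup>2"
        using sym[of i d "P i d"] idem[of i d] by (simp add: power2_norm_eq_inner)
    qed simp
    ultimately have "\<forall>i\<in>I. P i d = 0" using fin by (simp add: sum_nonneg_eq_0_iff)
    with v have "inner v d = 0" by blast
    moreover have "inner d m = 0" using orth[OF m] by (simp add: d_def)
    ultimately have "inner d d = 0" by (simp add: d_def inner_diff_left inner_diff_right inner_commute)
    then have "v = m" by (simp add: d_def)
    with m clC show ?thesis by (auto simp: C_def)
  qed
  with c show ?thesis by blast
qed

section \<open>Spectral measures\<close>

lemma orthogonal_projectionD: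
  assumes "orthogonal_projection P"
  shows "bounded_linear P" "inner (P x) y = inner x (P y)" "P (P x) = P x"
    "Re (cinner (P x) x) = (norm (P x))\<^sup>2"
proof -
  show "bounded_linear P" and sym: "inner (P x) y = inner x (P y)" for x y
    using assms
    by (auto simp: orthogonal_projection_def self_adjoint_def bounded_clinear_def inner_Re_cinner)
  show idem: "P (P x) = P x" for x
    using assms by (metis comp_apply orthogonal_projection_def)
  show "Re (cinner (P x) x) = (norm (P x))\<^sup>2"
    by (metis idem sym inner_Re_cinner power2_norm_eq_inner)
qed

lemma self_adjointD:
  assumes "self_adjoint A"
  shows "bounded_linear A" "inner (A x) y = inner x (A y)"
  using assms by (auto simp: self_adjoint_def bounded_clinear_def inner_Re_cinner)

lemma projection_valued_measureD:
  assumes "projection_valued_measure E"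
  shows "S \<in> sets borel \<Longrightarrow> orthogonal_projection (E S)"
    "S \<in> sets borel \<Longrightarrow> T \<in> sets borel \<Longrightarrow> E S (E T x) = E (S \<inter> T) x"
    "E {} x = 0" "E UNIV x = x"
    "range F \<subseteq> sets borel \<Longrightarrow> disjoint_family F \<Longrightarrow> (\<lambda>n::nat. E (F n) x) sums E (\<Union>n. F n) x"
  using assms by (auto simp: projection_valued_measure_def comp_def)

text \<open>Countable additivity for the sequence \<open>S\<close>, \<open>T\<close>,
  \<open>{}\<close>, \<open>{}\<close>, ...\<close>

lemma projection_valued_measure_Un:
  assumes E: "projection_valued_measure E"
    and S: "S \<in> sets borel" "T \<in> sets borel" "S \<inter> T = {}"
  shows "E (S \<union> T) x = E S x + E T x"
proof -
  let ?F = "binaryset S T"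
  have r: "range ?F \<subseteq> sets borel" using S by (auto simp: range_binaryset_eq)
  have d: "disjoint_family ?F"
    using S(3) by (auto simp: disjoint_family_on_def binaryset_def)
  have "(\<lambda>n. E (?F n) x) sums E (\<Union>n. ?F n) x"
    using projection_valued_measureD(5)[OF E r d] .
  moreover have "(\<lambda>n. E (?F n) x) sums (\<Sum>n<2. E (?F n) x)"
    by (rule sums_finite) (auto simp: binaryset_def projection_valued_measureD(3)[OF E] not_less)
  ultimately have "E (\<Union>n. ?F n) x = (\<Sum>n<2. E (?F n) x)" by (rule sums_unique2)
  then show ?thesis by (simp add: UN_binaryset_eq numeral_2_eq_2 binaryset_def)
qed

lemma projection_valued_measure_Compl:
  assumes E: "projection_valued_measure E" and S: "S \<in> sets borel"
  shows "E (- S) x = x - E S x"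
proof -
  have "E (S \<union> - S) x = E S x + E (- S) x"
    using S by (intro projection_valued_measure_Un[OF E]) auto
  moreover have "S \<union> - S = UNIV" by auto
  ultimately show ?thesis using projection_valued_measureD(4)[OF E, of x] by (metis add_diff_cancel_left')
qed

section \<open>Scalar spectral measures and the quadratic form of the operator\<close>

text \<open>Symmetry and idempotence turn the defining form into a squared norm, and strong
  countable additivity passes through the continuous inner product. Both are needed because
  \<open>measure_of\<close> takes the prescribed values only for a positive, countably additive set
  function.\<close>

lemma scalar_spectral_measure:
  assumes E: "projection_valued_measure E"
  shows sets_scalar_spectral_measure: "sets (scalar_spectral_measure E x) = sets borel"
    and space_scalar_spectral_measure: "space (scalar_spectral_measure E x) = UNIV"
    and emeasure_scalar_spectral_measure:
      "S \<in> sets borel \<Longrightarrow> emeasure (scalar_spectral_measure E x) S = ennreal ((norm (E S x))\<^sup>2)"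
    and finite_measure_scalar_spectral_measure: "finite_measure (scalar_spectral_measure E x)"
proof -
  let ?\<mu> = "\<lambda>S. ennreal (Re (cinner (E S x) x))"
  have eq: "Re (cinner (E S x) x) = (norm (E S x))\<^sup>2" if "S \<in> sets borel" for S
    using orthogonal_projectionD(4) projection_valued_measureD(1)[OF E that] by blast
  have sa: "sigma_algebra UNIV (sets (borel :: real measure))"
    by (metis sets.sigma_algebra_axioms space_borel)
  show sets: "sets (scalar_spectral_measure E x) = sets borel"
    and space: "space (scalar_spectral_measure E x) = UNIV"
    unfolding scalar_spectral_measure_def using sa sigma_algebra.sigma_sets_eq by auto
  have "positive (sets borel) ?\<mu>"
    using eq[of "{}"] by (simp add: positive_def projection_valued_measureD(3)[OF E])
  moreover have "countably_additive (sets borel) ?\<mu>"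
  proof (rule countably_additiveI)
    fix F :: "nat \<Rightarrow> real set"
    assume F: "range F \<subseteq> sets borel" "disjoint_family F" "(\<Union>n. F n) \<in> sets borel"
    have "(\<lambda>n. inner (E (F n) x) x) sums inner (E (\<Union>n. F n) x) x"
      using bounded_linear.sums[OF bounded_linear_inner_left projection_valued_measureD(5)[OF E F(1,2)]] .
    then have "(\<lambda>n. (norm (E (F n) x))\<^sup>2) sums (norm (E (\<Union>n. F n) x))\<^sup>2"
      using F by (subst (asm) (1 2) inner_Re_cinner) (auto simp: eq image_subset_iff)
    then have "(\<lambda>n. ?\<mu> (F n)) sums ?\<mu> (\<Union>n. F n)"
      using F by (auto simp: eq image_subset_iff)
    then show "(\<Sum>n. ?\<mu> (F n)) = ?\<mu> (\<Union>n. F n)" by (rule sums_unique[symmetric])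
  qed
  ultimately show em: "emeasure (scalar_spectral_measure E x) S = ennreal ((norm (E S x))\<^sup>2)"
    if "S \<in> sets borel" for S
    unfolding scalar_spectral_measure_def
    using emeasure_measure_of_sigma[OF sa _ _ that, of ?\<mu>] eq[OF that] by simp
  show "finite_measure (scalar_spectral_measure E x)"
    by (rule finite_measureI) (simp add: space em)
qed

text \<open>The scalar measure is finite and gives no mass to the complement of
  \<open>{-a..a}\<close>, so the integrand is bounded almost everywhere.\<close>

lemma spectral_measure_integrable:
  assumes A: "spectral_measure_of A E"
  shows "integrable (scalar_spectral_measure E x) (\<lambda>t. t)"
proof -
  let ?\<mu> = "scalar_spectral_measure E x"
  have E: "projection_valued_measure E" using A by (simp add: spectral_measure_of_def)
  obtain a where a: "E {-a..a} = id" using A by (auto simp: spectral_measure_of_def)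
  note [simp] = sets_scalar_spectral_measure[OF E] space_scalar_spectral_measure[OF E]
  interpret finite_measure ?\<mu> by (rule finite_measure_scalar_spectral_measure[OF E])
  have "emeasure ?\<mu> (- {-a..a}) = 0"
    by (simp add: emeasure_scalar_spectral_measure[OF E] projection_valued_measure_Compl[OF E] a)
  then have "AE t in ?\<mu>. norm t \<le> a"
    by (intro AE_I[of _ _ "- {-a..a}"]) (auto simp: abs_le_iff)
  moreover have "(\<lambda>t. t) \<in> borel_measurable ?\<mu>"
    by (subst measurable_cong_sets[OF sets_scalar_spectral_measure[OF E] refl]) simp
  ultimately show ?thesis by (intro integrable_const_bound[where B = a])
qed

lemma spectral_measure_quadratic_form:
  assumes "spectral_measure_of A E"
  shows "inner (A x) x = (\<integral>t. t \<partial>scalar_spectral_measure E x)"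
  using assms by (simp add: spectral_measure_of_def inner_Re_cinner)

text \<open>Multiplicativity of \<open>E\<close> makes the scalar measure of \<open>E S x\<close>
  the restriction to \<open>S\<close> of the scalar measure of \<open>x\<close>.\<close>

lemma spectral_measure_quadratic_form_restrict:
  assumes A: "spectral_measure_of A E" and S: "S \<in> sets borel"
  shows "inner (A (E S x)) (E S x) = (\<integral>t. indicator S t * t \<partial>scalar_spectral_measure E x)"
proof -
  have E: "projection_valued_measure E" using A by (simp add: spectral_measure_of_def)
  let ?\<mu> = "scalar_spectral_measure E x"
  note sets = sets_scalar_spectral_measure[OF E]
  have [simp]: "(\<lambda>t. t) \<in> borel_measurable ?\<mu>" "S \<in> sets ?\<mu>"
    using S by (simp_all add: measurable_cong_sets[OF sets refl] sets)
  have "scalar_spectral_measure E (E S x) = density ?\<mu> (indicator S)"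
  proof (rule measure_eqI)
    fix T assume "T \<in> sets (scalar_spectral_measure E (E S x))"
    then have T: "T \<in> sets borel" by (simp add: sets)
    have "emeasure (density ?\<mu> (indicator S)) T = emeasure ?\<mu> (S \<inter> T)"
      using S T by (intro emeasure_restricted) (simp_all add: sets)
    also have "\<dots> = emeasure (scalar_spectral_measure E (E S x)) T"
      using S T by (simp add: emeasure_scalar_spectral_measure[OF E] projection_valued_measureD(2)[OF E] Int_commute)
    finally show "emeasure (scalar_spectral_measure E (E S x)) T = emeasure (density ?\<mu> (indicator S)) T"
      by simp
  qed (simp add: sets)
  also have "\<dots> = density ?\<mu> (\<lambda>t. ennreal (indicator S t))"
    by (simp add: ennreal_indicator)
  finally have "inner (A (E S x)) (E S x) = (\<integral>t. t \<partial>density ?\<mu> (\<lambda>t. ennreal (indicator S t)))"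
    by (simp add: spectral_measure_quadratic_form[OF A])
  also have "\<dots> = (\<integral>t. indicator S t * t \<partial>?\<mu>)"
    using S by (subst integral_density) (simp_all add: measurable_cong_sets[OF sets refl])
  finally show ?thesis .
qed

section \<open>Reduction by spectral subspaces, the spectral lower bound and the kernel\<close>

text \<open>The defining integral speaks only of the diagonal \<open>cinner (A x) x\<close>. The
  integrals over \<open>S\<close> and its complement add up to the full one, so the cross terms of
  the quadratic form must cancel; by symmetry they are equal, hence each is zero.\<close>

lemma spectral_measure_reduces:
  assumes sa: "self_adjoint A" and A: "spectral_measure_of A E" and S: "S \<in> sets borel"
  shows "inner (A (x - E S x)) (E S x) = 0"
proof -
  have E: "projection_valued_measure E" using A by (simp add: spectral_measure_of_def)
  let ?\<mu> = "scalar_spectral_measure E x"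
  let ?p = "E S x" and ?q = "x - E S x"
  have int: "integrable ?\<mu> (\<lambda>t. indicator U t * t)" if "U \<in> sets borel" for U :: "real set"
    using integrable_mult_indicator[OF _ spectral_measure_integrable[OF A, of x], of U] that
    by (simp add: sets_scalar_spectral_measure[OF E])
  have "inner (A ?p) ?p + inner (A ?q) ?q = (\<integral>t. indicator S t * t \<partial>?\<mu>) + (\<integral>t. indicator (- S) t * t \<partial>?\<mu>)"
    using spectral_measure_quadratic_form_restrict[OF A, of S x]
      spectral_measure_quadratic_form_restrict[OF A, of "- S" x] S
    by (simp add: projection_valued_measure_Compl[OF E])
  also have "\<dots> = (\<integral>t. indicator S t * t + indicator (- S) t * t \<partial>?\<mu>)"
    using S by (intro Bochner_Integration.integral_add[symmetric] int) auto
  also have "\<dots> = (\<integral>t. t \<partial>?\<mu>)"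
    by (intro Bochner_Integration.integral_cong) (auto simp: indicator_def)
  also have "\<dots> = inner (A x) x" by (simp add: spectral_measure_quadratic_form[OF A])
  also have "\<dots> = inner (A (?p + ?q)) (?p + ?q)" by simp
  also have "\<dots> = inner (A ?p) ?p + inner (A ?q) ?q + 2 * inner (A ?q) ?p"
    using self_adjointD(2)[OF sa, of ?p ?q]
    by (simp only: linear_add[OF bounded_linear.linear[OF self_adjointD(1)[OF sa]]] inner_add_left inner_add_right
        inner_commute[of ?p "A ?q"])
  finally show ?thesis by simp
qed

text \<open>Test \<open>A x\<close> against \<open>(E {\<epsilon><..} - E {..<-\<epsilon>}) x\<close>, which has the same norm as \<open>x - E {-\<epsilon>..\<epsilon>} x\<close>;
  this avoids integrating \<open>t\<^sup>2\<close>.\<close>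

lemma spectral_measure_lower_bound:
  assumes sa: "self_adjoint A" and A: "spectral_measure_of A E" and \<epsilon>: "\<epsilon> \<ge> 0"
  shows "\<epsilon> * norm (x - E {-\<epsilon>..\<epsilon>} x) \<le> norm (A x)"
proof -
  have E: "projection_valued_measure E" using A by (simp add: spectral_measure_of_def)
  let ?\<mu> = "scalar_spectral_measure E x"
  define p where "p = E {\<epsilon><..} x"
  define n where "n = E {..<-\<epsilon>} x"
  have int: "integrable ?\<mu> (\<lambda>t. indicator U t * t)" "integrable ?\<mu> (\<lambda>t. indicator U t * \<epsilon>)"
    "(\<integral>t. indicator U t * \<epsilon> \<partial>?\<mu>) = \<epsilon> * (norm (E U x))\<^sup>2"
    if "U \<in> sets borel" for U :: "real set"
  proof -
    interpret finite_measure ?\<mu> by (rule finite_measure_scalar_spectral_measure[OF E])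
    have U: "U \<in> sets ?\<mu>" using that by (simp add: sets_scalar_spectral_measure[OF E])
    show "integrable ?\<mu> (\<lambda>t. indicator U t * t)"
      using integrable_mult_indicator[OF U spectral_measure_integrable[OF A, of x]] by simp
    show "integrable ?\<mu> (\<lambda>t. indicator U t * \<epsilon>)"
      using integrable_mult_indicator[OF U integrable_const[of \<epsilon>]] by simp
    show "(\<integral>t. indicator U t * \<epsilon> \<partial>?\<mu>) = \<epsilon> * (norm (E U x))\<^sup>2"
      using that U by (simp add: measure_def emeasure_scalar_spectral_measure[OF E] space_scalar_spectral_measure[OF E])
  qed
  have "\<epsilon> * (norm p)\<^sup>2 = (\<integral>t. indicator {\<epsilon><..} t * \<epsilon> \<partial>?\<mu>)" by (subst int(3)) (simp_all add: p_def)
  also have "\<dots> \<le> (\<integral>t. indicator {\<epsilon><..} t * t \<partial>?\<mu>)"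
    by (intro integral_mono int) (auto simp: indicator_def)
  also have "\<dots> = inner (A p) p" by (simp add: p_def spectral_measure_quadratic_form_restrict[OF A])
  \<comment> \<open>Reduction removes the contribution of \<open>x - p\<close>, so the bound can be
    tested against \<open>A x\<close> itself.\<close>
  also have "\<dots> = inner (A x) p"
    using spectral_measure_reduces[OF sa A, of "{\<epsilon><..}" x] linear_diff[OF bounded_linear.linear[OF self_adjointD(1)[OF sa]]]
    by (simp add: p_def inner_diff_left)
  finally have p: "\<epsilon> * (norm p)\<^sup>2 \<le> inner (A x) p" .
  have "inner (A x) n = inner (A n) n"
    using spectral_measure_reduces[OF sa A, of "{..<-\<epsilon>}" x] linear_diff[OF bounded_linear.linear[OF self_adjointD(1)[OF sa]]]
    by (simp add: n_def inner_diff_left)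
  also have "\<dots> = (\<integral>t. indicator {..<-\<epsilon>} t * t \<partial>?\<mu>)"
    by (simp add: n_def spectral_measure_quadratic_form_restrict[OF A])
  also have "\<dots> \<le> (\<integral>t. - (indicator {..<-\<epsilon>} t * \<epsilon>) \<partial>?\<mu>)"
    by (intro integral_mono int Bochner_Integration.integrable_minus) (auto simp: indicator_def)
  also have "\<dots> = - (\<epsilon> * (norm n)\<^sup>2)" by (subst integral_minus, subst int(3)) (simp_all add: n_def)
  finally have n: "inner (A x) n \<le> - (\<epsilon> * (norm n)\<^sup>2)" .
  have "E ({\<epsilon><..} \<union> {..<-\<epsilon>}) x = p + n"
    unfolding p_def n_def using \<epsilon> by (intro projection_valued_measure_Un[OF E]) auto
  moreover have "{\<epsilon><..} \<union> {..<-\<epsilon>} = - {-\<epsilon>..\<epsilon>}" by auto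
  ultimately have pn: "x - E {-\<epsilon>..\<epsilon>} x = p + n" by (simp add: projection_valued_measure_Compl[OF E])
  \<comment> \<open>Disjoint spectral sets give orthogonal vectors, so \<open>p - n\<close> and
    \<open>p + n\<close> have equal norms.\<close>
  have "inner p n = inner x (E {\<epsilon><..} n)"
    unfolding p_def by (intro orthogonal_projectionD(2) projection_valued_measureD(1)[OF E]) simp
  also have "E {\<epsilon><..} n = E ({\<epsilon><..} \<inter> {..<-\<epsilon>}) x"
    unfolding n_def by (intro projection_valued_measureD(2)[OF E]) auto
  also have "{\<epsilon><..} \<inter> {..<-\<epsilon>} = {}" using \<epsilon> by auto
  finally have orth: "inner p n = 0" by (simp add: projection_valued_measureD(3)[OF E])
  have sq: "(norm (p + n))\<^sup>2 = (norm p)\<^sup>2 + (norm n)\<^sup>2" "(norm (p - n))\<^sup>2 = (norm p)\<^sup>2 + (norm n)\<^sup>2"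
    using orth by (simp_all add: power2_norm_eq_inner inner_simps inner_commute)
  then have J: "norm (p - n) = norm (p + n)" by (metis norm_ge_zero power2_eq_imp_eq)
  have "\<epsilon> * (norm (p + n))\<^sup>2 \<le> inner (A x) (p - n)"
    unfolding sq(1) using p n by (simp add: inner_diff_right distrib_left)
  also have "\<dots> \<le> norm (A x) * norm (p + n)" using norm_cauchy_schwarz[of "A x" "p - n"] by (simp add: J)
  finally have *: "(\<epsilon> * norm (p + n)) * norm (p + n) \<le> norm (A x) * norm (p + n)"
    by (simp add: power2_eq_square mult.assoc)
  show ?thesis
  proof (cases "p + n = 0")
    case False
    with * show ?thesis by (simp add: pn)
  qed (simp add: pn)
qed

text \<open>On the range of \<open>E {0}\<close> the quadratic form of \<open>A\<close> vanishes;
  polarization and reduction then make \<open>A x\<close> orthogonal to itself. Conversely, if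
  \<open>A x = 0\<close>, the lower bound makes \<open>x\<close> a fixed vector of the projections
  of intervals shrinking to 0, so its scalar measure is carried by \<open>{0}\<close>.\<close>

lemma spectral_measure_kernel:
  assumes sa: "self_adjoint A" and A: "spectral_measure_of A E"
  shows "x \<in> range (E {0}) \<longleftrightarrow> A x = 0"
proof
  have E: "projection_valued_measure E" using A by (simp add: spectral_measure_of_def)
  have lin: "linear A" using self_adjointD(1)[OF sa] by (rule bounded_linear.linear)
  have vanish: "inner (A (E {0} z)) (E {0} z) = 0" for z
    unfolding spectral_measure_quadratic_form_restrict[OF A, of "{0}" z, simplified]
    by (rule integral_eq_zero_AE) (auto simp: indicator_def)
  show "A x = 0" if "x \<in> range (E {0})"
  proof -
    have "bounded_linear (E {0})"
      by (intro orthogonal_projectionD projection_valued_measureD(1)[OF E]) simp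
    then have add: "E {0} (u + v) = E {0} u + E {0} v" for u v
      by (simp add: linear_add bounded_linear.linear)
    have "E {0} x = x" using that projection_valued_measureD(2)[OF E, of "{0}" "{0}"] by auto
    define z where "z = A x"
    have "0 = inner (A (E {0} (x + z))) (E {0} (x + z))" by (simp add: vanish)
    also have "\<dots> = inner (A (E {0} x)) (E {0} x) + inner (A (E {0} z)) (E {0} z)
        + 2 * inner (A (E {0} x)) (E {0} z)"
      using self_adjointD(2)[OF sa, of "E {0} z" "E {0} x"]
      by (simp add: add linear_add[OF lin] inner_add_left inner_add_right inner_commute)
    finally have "inner (A x) (E {0} z) = 0" using \<open>E {0} x = x\<close> vanish[of x] vanish[of z] by simp
    moreover have "inner (A x) (z - E {0} z) = 0"
    proof -
      \<comment> \<open>Chosen so that \<open>E {0} u = x\<close> and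
        \<open>u - E {0} u = z - E {0} z\<close>, which makes the reduction lemma yield the desired
        pairing.\<close>
      define u where "u = x + (z - E {0} z)"
      have "E {0} (z - E {0} z) = 0"
        using projection_valued_measureD(2)[OF E, of "{0}" "- {0}" z] projection_valued_measureD(3)[OF E]
        by (simp add: projection_valued_measure_Compl[OF E])
      then have "E {0} u = x" using \<open>E {0} x = x\<close> by (simp add: u_def add)
      then show ?thesis
        using spectral_measure_reduces[OF sa A, of "{0}" u] self_adjointD(2)[OF sa, of x "z - E {0} z"]
        by (simp add: u_def inner_commute)
    qed
    ultimately have "inner (A x) z = 0" by (simp add: inner_diff_right)
    then show "A x = 0" by (simp add: z_def)
  qed
  show "x \<in> range (E {0})" if "A x = 0"
  proof -
    \<comment> \<open>Here the right side of the lower bound is zero while its factor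
      \<open>1 / Suc k\<close> is positive.\<close>
    have "E {-(1 / Suc k)..1 / Suc k} x = x" for k
      using spectral_measure_lower_bound[OF sa A, of "1 / Suc k" x] that by (simp add: divide_le_0_iff)
    then have "emeasure (scalar_spectral_measure E x) (- {-(1 / Suc k)..1 / Suc k}) = 0" for k
      by (simp add: emeasure_scalar_spectral_measure[OF E] projection_valued_measure_Compl[OF E])
    then have "emeasure (scalar_spectral_measure E x) (\<Union>k. - {-(1 / Suc k)..1 / Suc k}) = 0"
      by (intro emeasure_UN_eq_0) (auto simp: sets_scalar_spectral_measure[OF E])
    also have "(\<Union>k. - {-(1 / Suc k)..1 / real (Suc k)}) = - {0}"
    proof -
      have "\<exists>k. t \<notin> {-(1 / Suc k)..1 / real (Suc k)}" if t: "t \<noteq> 0" for t :: real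
      proof -
        obtain k where "inverse (real (Suc k)) < \<bar>t\<bar>" using reals_Archimedean[of "\<bar>t\<bar>"] t by auto
        then show ?thesis by (intro exI[of _ k]) (auto simp: inverse_eq_divide abs_if split: if_splits)
      qed
      then show ?thesis by fastforce
    qed
    finally have "x = E {0} x"
      by (simp add: emeasure_scalar_spectral_measure[OF E] projection_valued_measure_Compl[OF E])
    then show ?thesis by blast
  qed
qed

section \<open>Closedness of the sum of the ranges\<close>

lemma closed_sum_of_ranges:
  fixes A :: "'i \<Rightarrow> 'a::{real_inner,complete_space} \<Rightarrow> 'a"
  assumes fin: "finite I" and bl: "\<And>i. i \<in> I \<Longrightarrow> bounded_linear (A i)"
    and sym: "\<And>i x y. i \<in> I \<Longrightarrow> inner (A i x) y = inner x (A i y)"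
    and c: "c > 0"
    and lower: "\<And>x. (\<And>d. (\<And>i. i \<in> I \<Longrightarrow> A i d = 0) \<Longrightarrow> inner x d = 0) \<Longrightarrow>
        c * (norm x)\<^sup>2 \<le> (\<Sum>i\<in>I. (norm (A i x))\<^sup>2)"
  shows "closed {\<Sum>i\<in>I. A i (x i) | x. True}"
proof -
  define L where "L = {x. \<forall>d. (\<forall>i\<in>I. A i d = 0) \<longrightarrow> inner x d = 0}"
  define T where "T x = (\<Sum>i\<in>I. A i (A i x))" for x
  have T: "bounded_linear T"
    unfolding T_def using bounded_linear_compose bl by (intro bounded_linear_sum) blast
  have "L = (\<Inter>d\<in>{d. \<forall>i\<in>I. A i d = 0}. {x. inner x d = 0})" by (auto simp: L_def)
  then have clL: "closed L"
    by (auto intro!: closed_INT closed_Collect_eq continuous_intros)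
  have sub: "subspace L" by (auto simp: L_def subspace_def inner_add_left)
  have ranL: "(\<Sum>i\<in>I. A i (x i)) \<in> L" for x
    by (simp add: L_def inner_sum_left sym)
  have TL: "T x \<in> L" for x unfolding T_def by (rule ranL)
  have Tx: "inner (T x) x = (\<Sum>i\<in>I. (norm (A i x))\<^sup>2)" for x
    by (simp add: T_def inner_sum_left sym power2_norm_eq_inner)
  have cT: "c * (norm x)\<^sup>2 \<le> inner (T x) x" if "x \<in> L" for x
    unfolding Tx using that by (intro lower) (simp add: L_def)
  have "c * norm x \<le> norm (T x)" if "x \<in> L" for x
  proof (cases "x = 0")
    case False
    have "(c * norm x) * norm x \<le> norm (T x) * norm x"
      using cT[OF that] norm_cauchy_schwarz[of "T x" x] by (simp add: power2_eq_square mult.assoc)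
    with False show ?thesis by simp
  qed simp
  then have "complete (T ` L)"
    using complete_isometric_image[OF c sub T] clL complete_eq_closed by blast
  have "L \<subseteq> T ` L"
  proof
    fix z assume z: "z \<in> L"
    have "subspace (T ` L)" using T sub by (simp add: bounded_linear.linear linear_subspace_image)
    then obtain m where m: "m \<in> T ` L" and orth: "\<And>y. y \<in> T ` L \<Longrightarrow> inner (z - m) y = 0"
      using orthogonal_decomposition_complete_subspace \<open>complete (T ` L)\<close> by blast
    \<comment> \<open>The residual lies in \<open>L\<close> and is orthogonal to its own image under
      \<open>T\<close>, so coercivity annihilates it.\<close>
    have zm: "z - m \<in> L" using z m TL sub by (auto intro: subspace_diff)
    then have "c * (norm (z - m))\<^sup>2 \<le> 0"
      using cT[OF zm] orth[of "T (z - m)"] by (simp add: inner_commute)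
    then have "z = m" using c by (simp add: mult_le_0_iff)
    with m show "z \<in> T ` L" by simp
  qed
  moreover have "T x \<in> {\<Sum>i\<in>I. A i (x i) | x. True}" for x
    unfolding T_def by (intro CollectI exI[of _ "\<lambda>i. A i x"]) simp
  ultimately have "L \<subseteq> {\<Sum>i\<in>I. A i (x i) | x. True}" by blast
  moreover have "{\<Sum>i\<in>I. A i (x i) | x. True} \<subseteq> L" using ranL by auto
  ultimately have "{\<Sum>i\<in>I. A i (x i) | x. True} = L" by (rule subset_antisym[rotated])
  then show ?thesis using clL by simp
qed

section \<open>Passage from the complex notions to real sequences and inner products\<close>

lemma relatively_compact_map_compact_operator:
  assumes "compact_operator T"
  shows "relatively_compact_map T"
  unfolding relatively_compact_map_def
proof (intro allI impI)
  fix x :: "nat \<Rightarrow> 'a" assume "bounded (range x)"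
  then have "compact (closure (T ` range x))" using assms by (simp add: compact_operator_def)
  moreover have "\<forall>n. T (x n) \<in> closure (T ` range x)" by (intro allI subsetD[OF closure_subset]) simp
  ultimately obtain l r where "strict_mono r" "((\<lambda>n. T (x n)) \<circ> r) \<longlonglongrightarrow> l"
    unfolding compact_def by meson
  then show "\<exists>r. strict_mono r \<and> Cauchy (\<lambda>n. T (x (r n)))"
    using LIMSEQ_imp_Cauchy by (auto simp: comp_def)
qed

text \<open>The complex span of \<open>B\<close> lies in the real span of \<open>B\<close> together
  with its multiples by \<open>\<i>\<close>, whose bounded closed balls are compact.\<close>

lemma finite_cdim_bounded_subseq:
  fixes S :: "'a::chilbert_space set"
  assumes "finite_cdim S" "\<And>n. u n \<in> S" "bounded (range u)"
  obtains l and r :: "nat \<Rightarrow> nat" where "strict_mono r" "(\<lambda>n. u (r n)) \<longlonglongrightarrow> l"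
proof -
  obtain B where B: "finite B" "S = cvec.span B" using assms(1) by (auto simp: finite_cdim_def)
  define B' where "B' = B \<union> (\<lambda>b. \<i> *\<^sub>C b) ` B"
  have "S \<subseteq> span B'"
  proof
    fix x assume "x \<in> S"
    then show "x \<in> span B'"
      unfolding B(2)
    proof (induction rule: cvec.span_induct_alt)
      case base
      show ?case by (rule span_zero)
    next
      case (step c b y)
      have "c *\<^sub>C b = (complex_of_real (Re c) + complex_of_real (Im c) * \<i>) *\<^sub>C b"
        by (simp add: complex_eq_iff)
      also have "\<dots> = Re c *\<^sub>R b + Im c *\<^sub>R (\<i> *\<^sub>C b)"
        by (simp only: scaleC_add_left scaleR_scaleC scaleC_scaleC)
      also have "\<dots> \<in> span B'"
        using step by (intro span_add span_scale span_base) (auto simp: B'_def)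
      finally show ?case using step by (intro span_add)
    qed
  qed
  moreover obtain K where "\<And>n. norm (u n) \<le> K" using assms(3) by (auto simp: bounded_iff)
  ultimately have "\<forall>n. u n \<in> span B' \<inter> cball 0 K" using assms(2) by auto
  moreover have "compact (span B' \<inter> cball 0 K)"
    by (rule compact_span_Int_cball) (simp add: B'_def B)
  ultimately obtain l r where "strict_mono r" "(u \<circ> r) \<longlonglongrightarrow> l" unfolding compact_def by meson
  then show ?thesis using that by (simp add: comp_def)
qed

lemma orthogonal_projection_range_iff:
  assumes "orthogonal_projection P"
  shows "x \<in> range P \<longleftrightarrow> P x = x"
  using orthogonal_projectionD(3)[OF assms] by (metis rangeE rangeI)

text \<open>\<open>cinner\<close> is conjugate linear in its second argument, so the real inner
  product with \<open>\<i> *\<^sub>C y\<close> is the imaginary part of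
  \<open>cinner x y\<close>.\<close>

lemma cinner_eq_0_of_inner:
  fixes x y :: "'a::chilbert_space"
  assumes "inner x y = 0" "inner x (\<i> *\<^sub>C y) = 0"
  shows "cinner x y = 0"
proof -
  have "cinner x (\<i> *\<^sub>C y) = - \<i> * cinner x y"
    by (subst (1 2) cinner_commute) (simp add: cinner_scaleC_left)
  then have "Im (cinner x y) = 0" using assms(2) by (simp add: inner_Re_cinner)
  then show ?thesis using assms(1) by (simp add: complex_eq_iff inner_Re_cinner)
qed

text \<open>The spectral lower bound can only replace the outer factor of a product. Hence
  \<open>B \<circ> A\<close> is first replaced by \<open>Q \<circ> A\<close>, the factors are
  swapped to \<open>A \<circ> Q\<close>, and a second domination gives
  \<open>P \<circ> Q\<close>.\<close>

lemma relatively_compact_map_projections: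
  assumes A: "self_adjoint A" "spectral_measure_of A E" and B: "self_adjoint B" "spectral_measure_of B F"
    and AB: "compact_operator (B \<circ> A)" and \<epsilon>: "\<epsilon> > 0"
  shows "relatively_compact_map ((\<lambda>x. x - E {-\<epsilon>..\<epsilon>} x) \<circ> (\<lambda>x. x - F {-\<epsilon>..\<epsilon>} x))"
proof -
  define P where "P x = x - E {-\<epsilon>..\<epsilon>} x" for x
  define Q where "Q x = x - F {-\<epsilon>..\<epsilon>} x" for x
  have proj: "orthogonal_projection (E {-\<epsilon>..\<epsilon>})" "orthogonal_projection (F {-\<epsilon>..\<epsilon>})"
    using A B by (auto simp: spectral_measure_of_def intro: projection_valued_measureD(1))
  have P: "bounded_linear P" and Q: "bounded_linear Q"
    unfolding P_def Q_def by (intro bounded_linear_sub bounded_linear_ident orthogonal_projectionD(1) proj)+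
  have Qsym: "inner (Q x) y = inner x (Q y)" for x y
    using orthogonal_projectionD(2)[OF proj(2)] by (simp add: Q_def inner_diff_left inner_diff_right)
  note bl = self_adjointD(1)[OF A(1)] self_adjointD(1)[OF B(1)] P Q
  have lin: "linear (S \<circ> T)" if "bounded_linear S" "bounded_linear T" for S T :: "'a \<Rightarrow> 'a"
    using that by (simp add: bounded_linear.linear linear_compose)
  have PA: "norm (P x) \<le> 1 / \<epsilon> * norm (A x)" for x
    using spectral_measure_lower_bound[OF A, of \<epsilon> x] \<epsilon> by (simp add: P_def field_simps)
  have QB: "norm (Q x) \<le> 1 / \<epsilon> * norm (B x)" for x
    using spectral_measure_lower_bound[OF B, of \<epsilon> x] \<epsilon> by (simp add: Q_def field_simps)
  have "relatively_compact_map (Q \<circ> A)"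
    using relatively_compact_map_dominated[OF relatively_compact_map_compact_operator[OF AB] lin lin, of Q A "1 / \<epsilon>"]
      bl QB by simp
  then have "relatively_compact_map (A \<circ> Q)"
    by (rule relatively_compact_map_swap[OF bl(1) self_adjointD(2)[OF A(1)] bl(4) Qsym])
  then have "relatively_compact_map (P \<circ> Q)"
    by (rule relatively_compact_map_dominated[OF _ lin lin, of A Q P Q "1 / \<epsilon>"]) (simp_all add: bl PA del: times_divide_eq_left)
  then show ?thesis by (simp add: P_def[abs_def] Q_def[abs_def])
qed

theorem mainTheorem3:
  fixes A :: "nat \<Rightarrow> 'a::chilbert_space \<Rightarrow> 'a"
    and E :: "nat \<Rightarrow> real set \<Rightarrow> 'a \<Rightarrow> 'a"
    and N :: nat
  assumes "N \<ge> 2"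
    and "\<And>i. i \<in> {1..N} \<Longrightarrow> self_adjoint (A i)"
    and "\<And>i. i \<in> {1..N} \<Longrightarrow> spectral_measure_of (A i) (E i)"
    and "\<And>i j. i \<in> {1..N} \<Longrightarrow> j \<in> {1..N} \<Longrightarrow> i \<noteq> j \<Longrightarrow> compact_operator (A i \<circ> A j)"
    and "\<exists>\<epsilon>>0. finite_cdim (spectral_intersection N E \<epsilon> \<ominus>\<^sub>H spectral_intersection N E 0)"
  shows "closed {\<Sum>i=1..N. A i (x i) | x :: nat \<Rightarrow> 'a. True}"
proof -
  let ?I = "{1..N}"
  obtain \<epsilon> where \<epsilon>: "\<epsilon> > 0"
    and fin: "finite_cdim (spectral_intersection N E \<epsilon> \<ominus>\<^sub>H spectral_intersection N E 0)"
    using assms(5) by blast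
  define P where "P i x = x - E i {-\<epsilon>..\<epsilon>} x" for i x
  have E: "projection_valued_measure (E i)" if "i \<in> ?I" for i
    using assms(3)[OF that] by (simp add: spectral_measure_of_def)
  have proj: "orthogonal_projection (E i {-\<epsilon>..\<epsilon>})" if "i \<in> ?I" for i
    using E[OF that] by (intro projection_valued_measureD(1)) auto
  note blA = self_adjointD(1)[OF assms(2)] and symA = self_adjointD(2)[OF assms(2)]
  have blP: "bounded_linear (P i)" if "i \<in> ?I" for i
    unfolding P_def by (intro bounded_linear_sub bounded_linear_ident orthogonal_projectionD(1) proj that)
  have symP: "inner (P i x) y = inner x (P i y)" if "i \<in> ?I" for i x y
    using orthogonal_projectionD(2)[OF proj[OF that]] by (simp add: P_def inner_diff_left inner_diff_right)
  have idemP: "P i (P i x) = P i x" if "i \<in> ?I" for i x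
    using orthogonal_projectionD(1,3)[OF proj[OF that]]
    by (simp add: P_def linear_diff bounded_linear.linear)
  have compP: "relatively_compact_map (P i \<circ> P j)" if "i \<in> ?I" "j \<in> ?I" "i \<noteq> j" for i j
    using relatively_compact_map_projections[OF assms(2,3) assms(2,3) assms(4) \<epsilon>, of i j] that
    by (simp add: P_def[abs_def])
  have PA: "\<epsilon> * norm (P i x) \<le> norm (A i x)" if "i \<in> ?I" for i x
    using spectral_measure_lower_bound[OF assms(2,3), of i \<epsilon> x] \<epsilon> that by (simp add: P_def)
  have H\<epsilon>: "x \<in> spectral_intersection N E \<epsilon> \<longleftrightarrow> (\<forall>i\<in>?I. P i x = 0)" for x
    using orthogonal_projection_range_iff[OF proj] by (auto simp: spectral_intersection_def P_def)
  have H0: "x \<in> spectral_intersection N E 0 \<longleftrightarrow> (\<forall>i\<in>?I. A i x = 0)" for x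
    using spectral_measure_kernel[OF assms(2,3)] by (auto simp: spectral_intersection_def)
  obtain c where c: "c > 0"
    and lower: "\<And>v. (\<And>d. (\<And>i. i \<in> ?I \<Longrightarrow> P i d = 0) \<Longrightarrow> inner v d = 0) \<Longrightarrow>
      c * (norm v)\<^sup>2 \<le> (\<Sum>i\<in>?I. (norm (P i v))\<^sup>2)"
    using projection_family_lower_bound[of ?I P, OF _ blP symP idemP compP] by auto
  \<comment> \<open>Real orthogonality to the common kernel, the form required by
    \<open>closed_sum_of_ranges\<close>.\<close>
  define ort where "ort x \<longleftrightarrow> (\<forall>d. (\<forall>i\<in>?I. A i d = 0) \<longrightarrow> inner x d = 0)" for x
  have "\<exists>\<gamma>>0. \<forall>x. ort x \<longrightarrow> \<gamma> * (norm x)\<^sup>2 \<le> (\<Sum>i\<in>?I. (norm (A i x))\<^sup>2)"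
  proof (rule ccontr)
    assume "\<not> ?thesis"
    then have neg: "\<And>\<gamma>. \<gamma> > 0 \<Longrightarrow> \<exists>x. ort x \<and> (\<Sum>i\<in>?I. (norm (A i x))\<^sup>2) < \<gamma> * (norm x)\<^sup>2"
      by (force simp: not_le)
    have "\<exists>x. ort x \<and> norm x = 1 \<and> (\<Sum>i\<in>?I. (norm (A i x))\<^sup>2) \<le> 1 / Suc n" for n
    proof -
      obtain x where x: "ort x" "(\<Sum>i\<in>?I. (norm (A i x))\<^sup>2) < 1 / Suc n * (norm x)\<^sup>2"
        using neg[of "1 / Suc n"] by auto
      have "0 \<le> (\<Sum>i\<in>?I. (norm (A i x))\<^sup>2)" by (simp add: sum_nonneg)
      with x have nx: "norm x > 0" by (cases "x = 0") auto
      define y where "y = (1 / norm x) *\<^sub>R x"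
      have "norm (A i y) = norm (A i x) / norm x" if "i \<in> ?I" for i
        using blA[OF that] by (simp add: y_def linear_scale bounded_linear.linear divide_inverse)
      then have "(\<Sum>i\<in>?I. (norm (A i y))\<^sup>2) = (\<Sum>i\<in>?I. (norm (A i x))\<^sup>2) / (norm x)\<^sup>2"
        by (simp add: power_divide sum_divide_distrib)
      also have "\<dots> \<le> 1 / Suc n" using x(2) nx by (simp add: pos_divide_le_eq)
      finally show ?thesis using x(1) nx by (intro exI[of _ y]) (simp add: ort_def y_def)
    qed
    then obtain x where ort: "\<And>n. ort (x n)" and nx: "\<And>n. norm (x n) = 1"
      and Ax: "\<And>n. (\<Sum>i\<in>?I. (norm (A i (x n)))\<^sup>2) \<le> 1 / Suc n" by metis
    have Ax0: "(\<lambda>n. A i (x n)) \<longlonglongrightarrow> 0" if "i \<in> ?I" for i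
    proof -
      have "(norm (A i (x n)))\<^sup>2 \<le> 1 / Suc n" for n
        by (rule order_trans[OF _ Ax]) (intro member_le_sum that; simp)
      then have "(\<lambda>n. (norm (A i (x n)))\<^sup>2) \<longlonglongrightarrow> 0"
        by (intro tendsto_sandwich[OF _ _ tendsto_const LIMSEQ_Suc[OF lim_1_over_n]] always_eventually)
          simp_all
      then have "(\<lambda>n. sqrt ((norm (A i (x n)))\<^sup>2)) \<longlonglongrightarrow> sqrt 0" by (rule tendsto_real_sqrt)
      then show ?thesis by (simp add: tendsto_norm_zero_iff)
    qed
    have Px0: "(\<lambda>n. P i (x n)) \<longlonglongrightarrow> 0" if "i \<in> ?I" for i
    proof (rule Lim_null_comparison)
      show "\<forall>\<^sub>F n in sequentially. norm (P i (x n)) \<le> 1 / \<epsilon> * norm (A i (x n))"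
        using PA[OF that] \<epsilon> by (intro always_eventually) (simp add: field_simps)
      show "(\<lambda>n. 1 / \<epsilon> * norm (A i (x n))) \<longlonglongrightarrow> 0"
        using tendsto_mult_left[OF tendsto_norm_zero[OF Ax0[OF that]], of "1 / \<epsilon>"] by simp
    qed
    \<comment> \<open>By \<open>H\<epsilon>\<close> this is
      \<open>spectral_intersection N E \<epsilon>\<close>; below, \<open>u n\<close> is the
      orthogonal projection of \<open>x n\<close> onto it.\<close>
    define L where "L = {v. \<forall>i\<in>?I. P i v = 0}"
    have "L = (\<Inter>i\<in>?I. {v. P i v = 0})" by (auto simp: L_def)
    then have "closed L"
      using blP by (auto intro!: closed_INT closed_Collect_eq linear_continuous_on continuous_intros)
    then have "complete L" by (simp add: complete_eq_closed)
    have "subspace L"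
      using blP by (auto simp: L_def subspace_def linear_0 linear_add linear_scale bounded_linear.linear)
    have "\<exists>u\<in>L. \<forall>y\<in>L. inner (x n - u) y = 0" for n
      using orthogonal_decomposition_complete_subspace[OF \<open>subspace L\<close> \<open>complete L\<close>] by metis
    then obtain u where uL: "\<And>n. u n \<in> L" and u: "\<And>n y. y \<in> L \<Longrightarrow> inner (x n - u n) y = 0" by metis
    have "(\<lambda>n. x n - u n) \<longlonglongrightarrow> 0"
    proof -
      \<comment> \<open>The residual is orthogonal to the common kernel of the \<open>P i\<close>,
        so \<open>lower\<close> applies to it, and its components are those of \<open>x n\<close>,
        which tend to 0.\<close>
      have Pv: "P i (x n - u n) = P i (x n)" if "i \<in> ?I" for i n
        using blP[OF that] uL[of n] that by (simp add: L_def linear_diff bounded_linear.linear)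
      have le: "(norm (x n - u n))\<^sup>2 \<le> (\<Sum>i\<in>?I. (norm (P i (x n)))\<^sup>2) / c" for n
        using lower[of "x n - u n"] u[of _ n] c by (simp add: L_def Pv field_simps)
      have "(\<lambda>n. (\<Sum>i\<in>?I. (norm (P i (x n)))\<^sup>2) / c) \<longlonglongrightarrow> (\<Sum>i\<in>?I. (norm (0::'a))\<^sup>2) / c"
        using c by (intro tendsto_intros Px0) auto
      then have "(\<lambda>n. (\<Sum>i\<in>?I. (norm (P i (x n)))\<^sup>2) / c) \<longlonglongrightarrow> 0" by simp
      then have "(\<lambda>n. (norm (x n - u n))\<^sup>2) \<longlonglongrightarrow> 0"
      proof (rule tendsto_sandwich[OF _ _ tendsto_const, rotated 2])
        show "\<forall>\<^sub>F n in sequentially. (norm (x n - u n))\<^sup>2 \<le> (\<Sum>i\<in>?I. (norm (P i (x n)))\<^sup>2) / c"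
          by (rule always_eventually) (rule allI, rule le)
      qed simp
      then have "(\<lambda>n. sqrt ((norm (x n - u n))\<^sup>2)) \<longlonglongrightarrow> sqrt 0" by (rule tendsto_real_sqrt)
      then show ?thesis by (simp add: tendsto_norm_zero_iff)
    qed
    have "norm (u n) \<le> 1" for n
    proof -
      have "(norm (u n))\<^sup>2 = inner (x n) (u n)"
        using u[OF uL, of n n] by (simp add: power2_norm_eq_inner inner_diff_left)
      also have "\<dots> \<le> norm (u n)" using norm_cauchy_schwarz[of "x n" "u n"] by (simp add: nx)
      finally show ?thesis by (cases "u n = 0") (simp_all add: power2_eq_square)
    qed
    then have "bounded (range u)" by (auto simp: bounded_iff)
    have "cinner (u n) y = 0" if "y \<in> spectral_intersection N E 0" for n y
    proof -
      \<comment> \<open>The common kernel of the \<open>A i\<close> lies in \<open>L\<close>, and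
        \<open>u n\<close> differs from \<open>x n\<close> by a vector orthogonal to
        \<open>L\<close>. Using this for both \<open>y\<close> and \<open>\<i> *\<^sub>C y\<close>
        gives complex orthogonality.\<close>
      have *: "inner (u n) z = 0" if z: "\<forall>i\<in>?I. A i z = 0" for z
      proof -
        have "z \<in> L"
        proof -
          have "P i z = 0" if "i \<in> ?I" for i
            using PA[OF that, of z] z that \<epsilon> by (simp add: mult_le_0_iff)
          then show ?thesis by (simp add: L_def)
        qed
        moreover have "inner (x n) z = 0" using ort[of n] z by (simp add: ort_def)
        ultimately show ?thesis using u[of z n] by (simp add: inner_diff_left)
      qed
      have y: "A i y = 0" if "i \<in> ?I" for i using H0 \<open>y \<in> _\<close> that by blast
      moreover have "A i (\<i> *\<^sub>C y) = 0" if "i \<in> ?I" for i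
        using assms(2)[OF that] y[OF that] by (simp add: self_adjoint_def bounded_clinear_def)
      ultimately show ?thesis using cinner_eq_0_of_inner * by blast
    qed
    then have "u n \<in> spectral_intersection N E \<epsilon> \<ominus>\<^sub>H spectral_intersection N E 0" for n
      using uL[of n] by (simp add: ominus_def H\<epsilon> L_def)
    then obtain l and r :: "nat \<Rightarrow> nat" where r: "strict_mono r" "(\<lambda>n. u (r n)) \<longlonglongrightarrow> l"
      using finite_cdim_bounded_subseq[OF fin _ \<open>bounded (range u)\<close>] by metis
    \<comment> \<open>The unit vectors \<open>x (r n)\<close> inherit the limit \<open>l\<close>,
      which then lies in the common kernel although every \<open>x (r n)\<close> is orthogonal to
      it.\<close>
    have "(\<lambda>n. (x (r n) - u (r n)) + u (r n)) \<longlonglongrightarrow> 0 + l"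
      using LIMSEQ_subseq_LIMSEQ[OF \<open>(\<lambda>n. x n - u n) \<longlonglongrightarrow> 0\<close> r(1)] r(2)
      by (intro tendsto_add) (simp_all add: comp_def)
    then have xl: "(\<lambda>n. x (r n)) \<longlonglongrightarrow> l" by simp
    have "A i l = 0" if "i \<in> ?I" for i
    proof (rule LIMSEQ_unique)
      show "(\<lambda>n. A i (x (r n))) \<longlonglongrightarrow> A i l" using bounded_linear.tendsto[OF blA[OF that] xl] .
      show "(\<lambda>n. A i (x (r n))) \<longlonglongrightarrow> 0"
        using LIMSEQ_subseq_LIMSEQ[OF Ax0[OF that] r(1)] by (simp add: comp_def)
    qed
    then have "inner (x (r n)) l = 0" for n using ort by (simp add: ort_def)
    then have "(\<lambda>n. 0) \<longlonglongrightarrow> inner l l"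
      using tendsto_inner[OF xl tendsto_const[of l]] by simp
    then have "l = 0" using LIMSEQ_unique[OF tendsto_const] by fastforce
    moreover have "norm l = 1"
      using LIMSEQ_unique[OF tendsto_norm[OF xl]] by (simp add: nx)
    ultimately show False by simp
  qed
  then obtain \<gamma> where "\<gamma> > 0" "\<And>x. ort x \<Longrightarrow> \<gamma> * (norm x)\<^sup>2 \<le> (\<Sum>i\<in>?I. (norm (A i x))\<^sup>2)"
    by blast
  then show ?thesis
    by (intro closed_sum_of_ranges[of ?I A \<gamma>] blA symA) (auto simp: ort_def)
qed

end
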